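(* Let $\lambda$ be a frequency, $(G,\beta)$ a $\lambda$-Dirichlet group, and $f_n,f\in H_1^\lambda(G)$ ($n\in\mathbb N$). Then the following are equivalent: (1) $\lim_{n\to\infty}f_n(\omega)=f(\omega)$ for almost all $\omega\in G$; (2) $\lim_{n\to\infty}(f_n)_\omega(t)=f_\omega(t)$ for almost all $\omega\in G$ and for almost all $t\in\mathbb R$. In particular, if all $f_n$ are polynomials and $D_n\in\mathcal H_1(\lambda)$ are the Dirichlet polynomials associated to $f_n$ under the Bohr transform, then (1) and (2) are equivalent to each of the following two further statements: (3) $\lim_{n\to\infty}D_n^\omega(0)=f(\omega)$ for almost all $\omega\in G$; (4) $\lim_{n\to\infty}D_n^\omega(it)=f_\omega(t)$ for almost all $\omega\in G$ and for almost all $t\in\mathbb R$.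
   Context: A frequency is a strictly increasing, unbounded sequence $\lambda=(\lambda_j)_{j\in\mathbb N}$ of non-negative real numbers. A Dirichlet group $(G,\beta)$ is a compact abelian group $G$ together with a continuous homomorphism $\beta:(\mathbb R,+)\to G$ with dense range; it is a $\lambda$-Dirichlet group if for every $j$ there is a (then unique) character $h_{\lambda_j}\in\widehat G$ with $h_{\lambda_j}(\beta(t))=e^{-i\lambda_jt}$ for all $t\in\mathbb R$. $L_1(G)$ and "almost all $\omega$" refer to the normalized Haar measure $m$; $\widehat f(\gamma)=\int_Gf\,\overline\gamma\,dm$. $H_1^\lambda(G)$ is the space of all $f\in L_1(G)$ such that $\widehat f(\gamma)\ne0$ implies $\gamma=h_{\lambda_j}$ for some $j$. For $f\in L_1(G)$ (with a fixed representative), for almost all $\omega\in G$ there is a locally integrable $f_\omega:\mathbb R\to\mathbb C$ with $f_\omega(t)=f(\omega\beta(t))$ for almost all $t$. A polynomial in $H_1^\lambda(G)$ is a finite linear combination of the characters $h_{\lambda_j}$. The Bohr transform maps $g\in H_1^\lambda(G)$ to the formal Dirichlet series $D=\sum_j\widehat g(h_{\lambda_j})e^{-\lambda_js}$; $\mathcal H_1(\lambda)$ is the set of all such series. For $D=\sum_ja_je^{-\lambda_js}$ and $\omega\in G$ put $D^\omega(s)=\sum_ja_jh_{\lambda_j}(\omega)e^{-\lambda_js}$ (a finite sum for Dirichlet polynomials). *)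

theory Defs
  imports "HOL-Analysis.Analysis"
begin

text \<open>
  Groups are written additively: \<open>\<omega> + \<beta> t\<close> stands for $\omega\beta(t)$.  The index set of a
  frequency is the type \<open>nat\<close>.
\<close>

definition frequency :: "(nat \<Rightarrow> real) \<Rightarrow> bool" where
  "frequency lam \<longleftrightarrow> strict_mono lam \<and> (\<forall>j. 0 \<le> lam j) \<and> \<not> bdd_above (range lam)"

definition dirichlet_group :: "(real \<Rightarrow> 'a::{topological_ab_group_add, t2_space}) \<Rightarrow> bool" where
  "dirichlet_group \<beta> \<longleftrightarrow>
     compact (UNIV :: 'a set) \<and>
     continuous_on UNIV \<beta> \<and> (\<forall>s t. \<beta> (s + t) = \<beta> s + \<beta> t) \<and>
     closure (range \<beta>) = UNIV"

definition character :: "('a::topological_ab_group_add \<Rightarrow> complex) \<Rightarrow> bool" where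
  "character \<gamma> \<longleftrightarrow>
     continuous_on UNIV \<gamma> \<and> (\<forall>x y. \<gamma> (x + y) = \<gamma> x * \<gamma> y) \<and> (\<forall>x. norm (\<gamma> x) = 1)"

definition extends_frequency ::
    "(real \<Rightarrow> 'a::topological_ab_group_add) \<Rightarrow> real \<Rightarrow> ('a \<Rightarrow> complex) \<Rightarrow> bool" where
  "extends_frequency \<beta> x h \<longleftrightarrow>
     character h \<and> (\<forall>t. h (\<beta> t) = exp (- \<i> * of_real x * of_real t))"

definition lambda_dirichlet_group ::
    "(nat \<Rightarrow> real) \<Rightarrow> (real \<Rightarrow> 'a::{topological_ab_group_add, t2_space}) \<Rightarrow> bool" where
  "lambda_dirichlet_group lam \<beta> \<longleftrightarrow>
     dirichlet_group \<beta> \<and> (\<forall>j. \<exists>h. extends_frequency \<beta> (lam j) h)"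

text \<open>The character $h_x$; it is unique when it exists, since \<open>\<beta>\<close> has dense range.\<close>

definition freq_char :: "(real \<Rightarrow> 'a::topological_ab_group_add) \<Rightarrow> real \<Rightarrow> 'a \<Rightarrow> complex" where
  "freq_char \<beta> x = (THE h. extends_frequency \<beta> x h)"

text \<open>
  The normalized Haar measure of a compact group: the translation-invariant Radon probability
  measure.  Regularity has to be required because the group need not be metrizable.
\<close>

definition normalized_haar_measure ::
    "'a::{topological_ab_group_add, t2_space} measure \<Rightarrow> bool" where
  "normalized_haar_measure m \<longleftrightarrow>
     sets m = sets borel \<and>
     emeasure m UNIV = 1 \<and>
     (\<forall>x. \<forall>A\<in>sets borel. emeasure m ((+) x ` A) = emeasure m A) \<and>
     (\<forall>A\<in>sets borel. emeasure m A = (INF U\<in>{U. open U \<and> A \<subseteq> U}. emeasure m U)) \<and>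
     (\<forall>U. open U \<longrightarrow> emeasure m U = (SUP K\<in>{K. compact K \<and> K \<subseteq> U}. emeasure m K))"

definition fourier_coeff :: "'a measure \<Rightarrow> ('a \<Rightarrow> complex) \<Rightarrow> ('a \<Rightarrow> complex) \<Rightarrow> complex" where
  "fourier_coeff m f \<gamma> = (\<integral>\<omega>. f \<omega> * cnj (\<gamma> \<omega>) \<partial>m)"

text \<open>Elements of $L_1(G)$ are given by representatives, that is, by integrable functions.\<close>

definition hardy_H1 ::
    "'a::{topological_ab_group_add, t2_space} measure \<Rightarrow> (nat \<Rightarrow> real) \<Rightarrow> (real \<Rightarrow> 'a)
      \<Rightarrow> ('a \<Rightarrow> complex) set" where
  "hardy_H1 m lam \<beta> =
     {f. integrable m f \<and>
         (\<forall>\<gamma>. character \<gamma> \<and> fourier_coeff m f \<gamma> \<noteq> 0 \<longrightarrow> (\<exists>j. \<gamma> = freq_char \<beta> (lam j)))}"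

definition locally_integrable :: "(real \<Rightarrow> complex) \<Rightarrow> bool" where
  "locally_integrable g \<longleftrightarrow> (\<forall>K. compact K \<longrightarrow> g absolutely_integrable_on K)"

text \<open>
  The function $f_\omega$.  It exists for almost all \<open>\<omega>\<close> and is determined up to a null set of
  arguments; a version is chosen.  Where it does not exist the value is unspecified.
\<close>

definition fibre ::
    "(real \<Rightarrow> 'a::topological_ab_group_add) \<Rightarrow> ('a \<Rightarrow> complex) \<Rightarrow> 'a \<Rightarrow> real \<Rightarrow> complex" where
  "fibre \<beta> f \<omega> =
     (SOME g. locally_integrable g \<and> (AE t in lborel. g t = f (\<omega> + \<beta> t)))"

text \<open>Equality holds almost everywhere because \<open>f\<close> represents an element of $L_1(G)$.\<close>

definition H1_polynomial ::
    "'a::topological_ab_group_add measure \<Rightarrow> (nat \<Rightarrow> real) \<Rightarrow> (real \<Rightarrow> 'a)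
      \<Rightarrow> ('a \<Rightarrow> complex) \<Rightarrow> bool" where
  "H1_polynomial m lam \<beta> f \<longleftrightarrow>
     (\<exists>J c. finite J \<and> (AE \<omega> in m. f \<omega> = (\<Sum>j\<in>J. c j * freq_char \<beta> (lam j) \<omega>)))"

text \<open>
  A formal Dirichlet series $\sum_j a_j e^{-\lambda_j s}$ over a fixed frequency is represented by
  its sequence of coefficients.
\<close>

type_synonym dirichlet_series = "nat \<Rightarrow> complex"

definition bohr_transform ::
    "'a::topological_ab_group_add measure \<Rightarrow> (nat \<Rightarrow> real) \<Rightarrow> (real \<Rightarrow> 'a)
      \<Rightarrow> ('a \<Rightarrow> complex) \<Rightarrow> dirichlet_series" where
  "bohr_transform m lam \<beta> g = (\<lambda>j. fourier_coeff m g (freq_char \<beta> (lam j)))"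

definition twist ::
    "(nat \<Rightarrow> real) \<Rightarrow> (real \<Rightarrow> 'a::topological_ab_group_add) \<Rightarrow> dirichlet_series \<Rightarrow> 'a
      \<Rightarrow> dirichlet_series" where
  "twist lam \<beta> D \<omega> = (\<lambda>j. D j * freq_char \<beta> (lam j) \<omega>)"

text \<open>The value at \<open>s\<close> of a Dirichlet polynomial, i.e. of a series with finite support.\<close>

definition dirichlet_poly_eval ::
    "(nat \<Rightarrow> real) \<Rightarrow> dirichlet_series \<Rightarrow> complex \<Rightarrow> complex" where
  "dirichlet_poly_eval lam D s = (\<Sum>j | D j \<noteq> 0. D j * exp (- of_real (lam j) * s))"

end

theory Submission
  imports Defs
begin

text \<open>
  Fubini's theorem on \<open>G \<times> \<real>\<close> and translation invariance of the Haar measure show that a Borel set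
  has full measure in \<open>G\<close> iff almost every orbit \<open>t \<mapsto> \<omega> + \<beta> t\<close> spends almost all of its time in it.
  Applied to the set of convergence, this is the equivalence of pointwise convergence on \<open>G\<close> and
  along the fibres.  For polynomials, orthogonality of the characters identifies the Bohr
  coefficients, so that the twisted Dirichlet polynomial at \<open>\<i>t\<close> is the polynomial at \<open>\<omega> + \<beta> t\<close>.
\<close>

section \<open>Joint measurability of the flow\<close>

text \<open>
  One second countable factor suffices: for each basic open set \<open>V\<close> of that factor, the union of
  all open \<open>W\<close> with \<open>W \<times> V \<subseteq> U\<close> is again open, however large the family of those \<open>W\<close>.
\<close>

lemma open_in_sets_pair_borel:
  fixes U :: "('a::topological_space \<times> 'b::second_countable_topology) set"
  assumes "open U"
  shows "U \<in> sets (borel \<Otimes>\<^sub>M borel)"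
proof -
  obtain B :: "'b set set" where B: "countable B" "topological_basis B"
    using ex_countable_basis by blast
  define W where "W V = \<Union>{W :: 'a set. open W \<and> W \<times> V \<subseteq> U}" for V
  have "U = (\<Union>V\<in>B. W V \<times> V)"
  proof (intro equalityI subsetI)
    fix p assume p: "p \<in> U"
    from open_prod_elim[OF assms p] obtain A C
      where AC: "open A" "open C" "p \<in> A \<times> C" "A \<times> C \<subseteq> U" by metis
    then have "snd p \<in> C" by auto
    from topological_basisE[OF B(2) AC(2) this]
    obtain V where V: "V \<in> B" "snd p \<in> V" "V \<subseteq> C" by metis
    have "A \<times> V \<subseteq> U" using AC V by blast
    then have "fst p \<in> W V" unfolding W_def using AC by (auto simp: mem_Times_iff)
    then show "p \<in> (\<Union>V\<in>B. W V \<times> V)" using V by (auto simp: mem_Times_iff)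
  qed (auto simp: W_def)
  moreover have "W V \<times> V \<in> sets (borel \<Otimes>\<^sub>M borel)" if "V \<in> B" for V
  proof -
    have "open (W V)" unfolding W_def by auto
    moreover have "open V" using B that topological_basis_open by blast
    ultimately show ?thesis by (intro pair_measureI borel_open)
  qed
  ultimately show ?thesis using sets.countable_UN''[OF B(1), of "\<lambda>V. W V \<times> V"] by simp
qed

text \<open>Fubini needs measurability for the product of the two Borel sigma-algebras. Joint
  continuity gives open preimages, and these lie in that product because the time axis is second
  countable; the group itself may fail to be.\<close>

lemma measurable_flow:
  fixes \<beta> :: "real \<Rightarrow> 'a::topological_ab_group_add"
  assumes "continuous_on UNIV \<beta>"
  shows "(\<lambda>(\<omega>, t). \<omega> + \<beta> t) \<in> borel \<Otimes>\<^sub>M borel \<rightarrow>\<^sub>M borel"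
proof (rule borel_measurableI)
  fix S :: "'a set" assume "open S"
  have "continuous_on UNIV (\<lambda>p :: 'a \<times> real. fst p + \<beta> (snd p))"
    by (intro continuous_intros continuous_on_compose2[OF assms]) auto
  then have "open ((\<lambda>p :: 'a \<times> real. fst p + \<beta> (snd p)) -` S)"
    using \<open>open S\<close> by (simp add: open_vimage)
  then show "(\<lambda>(\<omega>, t). \<omega> + \<beta> t) -` S \<inter> space (borel \<Otimes>\<^sub>M borel) \<in> sets (borel \<Otimes>\<^sub>M borel)"
    by (auto simp: space_pair_measure split_beta' dest: open_in_sets_pair_borel)
qed

section \<open>Haar measure and translations\<close>

lemma measurable_translation:
  fixes x :: "'a::topological_ab_group_add"
  shows "(\<lambda>\<omega>. \<omega> + x) \<in> borel \<rightarrow>\<^sub>M borel"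
  by (intro borel_measurable_continuous_onI continuous_intros)

lemma haar_sets:
  "normalized_haar_measure m \<Longrightarrow> sets m = sets borel"
  by (simp add: normalized_haar_measure_def)

lemma haar_emeasure_space:
  assumes "normalized_haar_measure m"
  shows "emeasure m (space m) = 1"
  using assms sets_eq_imp_space_eq[OF haar_sets[OF assms]]
  by (simp only: normalized_haar_measure_def space_borel)

lemma haar_finite_measure:
  assumes "normalized_haar_measure m"
  shows "finite_measure m"
  by (rule finite_measureI) (simp add: haar_emeasure_space[OF assms])

text \<open>Invariance is assumed for translated images of sets, while a change of variables needs
  it for preimages; the preimage under translation by \<open>x\<close> is the image under
  translation by \<open>- x\<close>.\<close>

lemma haar_distr_translation:
  fixes m :: "'a::{topological_ab_group_add, t2_space} measure"
  assumes "normalized_haar_measure m"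
  shows "distr m m (\<lambda>\<omega>. \<omega> + x) = m"
proof (rule measure_eqI)
  fix A assume "A \<in> sets (distr m m (\<lambda>\<omega>. \<omega> + x))"
  then have A: "A \<in> sets borel" using haar_sets[OF assms] by simp
  have "(\<lambda>\<omega>. \<omega> + x) -` A = (+) (- x) ` A"
  proof (intro equalityI subsetI)
    fix \<omega> assume "\<omega> \<in> (\<lambda>\<omega>. \<omega> + x) -` A"
    then show "\<omega> \<in> (+) (- x) ` A" by (intro image_eqI[of _ _ "\<omega> + x"]) auto
  qed auto
  moreover have "emeasure m ((+) (- x) ` A) = emeasure m A"
    using assms A unfolding normalized_haar_measure_def by (elim conjE) (erule allE, erule bspec)
  moreover have "(\<lambda>\<omega>. \<omega> + x) \<in> m \<rightarrow>\<^sub>M m"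
    using measurable_translation measurable_cong_sets[OF haar_sets[OF assms] haar_sets[OF assms]]
    by blast
  ultimately show "emeasure (distr m m (\<lambda>\<omega>. \<omega> + x)) A = emeasure m A"
    using A haar_sets[OF assms] sets_eq_imp_space_eq[OF haar_sets[OF assms]]
    by (subst emeasure_distr) simp_all
qed simp

section \<open>Fubini along the orbits\<close>

text \<open>After exchanging the two quantifiers, the inner statement for fixed \<open>t\<close>
  concerns a translate of \<open>P\<close>, so by invariance it does not depend on
  \<open>t\<close>.\<close>

lemma AE_flow_iff:
  fixes \<beta> :: "real \<Rightarrow> 'a::{topological_ab_group_add, t2_space}"
  assumes \<beta>: "continuous_on UNIV \<beta>" and m: "normalized_haar_measure m"
    and P: "Measurable.pred borel P"
  shows "(AE \<omega> in m. AE t in lborel. P (\<omega> + \<beta> t)) \<longleftrightarrow> (AE \<omega> in m. P \<omega>)"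
proof -
  interpret m: finite_measure m by (rule haar_finite_measure[OF m])
  interpret pair_sigma_finite m lborel ..
  note [measurable_cong] = haar_sets[OF m]
  note [measurable] = measurable_flow[OF \<beta>] measurable_translation P
  have [measurable]: "(\<lambda>p. fst p + \<beta> (snd p)) \<in> m \<Otimes>\<^sub>M lborel \<rightarrow>\<^sub>M borel"
    using measurable_flow[OF \<beta>]
    by (simp add: split_beta' cong: measurable_cong_sets sets_pair_measure_cong haar_sets[OF m])
  have "(AE \<omega> in m. AE t in lborel. P (\<omega> + \<beta> t)) \<longleftrightarrow> (AE t in lborel. AE \<omega> in m. P (\<omega> + \<beta> t))"
    by (rule AE_commute) measurable
  also have "\<dots> \<longleftrightarrow> (AE t in (lborel :: real measure). AE \<omega> in m. P \<omega>)"
  proof -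
    have "(AE \<omega> in m. P (\<omega> + x)) \<longleftrightarrow> (AE \<omega> in m. P \<omega>)" for x
      using AE_distr_iff[of "\<lambda>\<omega>. \<omega> + x" m m P] unfolding haar_distr_translation[OF m] by simp
    then show ?thesis by simp
  qed
  \<comment> \<open>A statement free of \<open>t\<close> can be pulled out because Lebesgue measure
    on the line is not zero.\<close>
  also have "\<dots> \<longleftrightarrow> (AE \<omega> in m. P \<omega>)"
    by (cases "AE \<omega> in m. P \<omega>") (auto simp: AE_iff_null)
  finally show ?thesis .
qed

text \<open>Since \<open>fibre\<close> is a choice, it has the expected values only where some
  locally integrable version exists. Fubini for the norm of \<open>f\<close> over the group times a
  bounded interval shows that the orbit function itself is such a version for almost all
  \<omega>.\<close>

lemma AE_fibre_eq:
  fixes \<beta> :: "real \<Rightarrow> 'a::{topological_ab_group_add, t2_space}"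
  assumes \<beta>: "continuous_on UNIV \<beta>" and m: "normalized_haar_measure m"
    and f: "integrable m f"
  shows "AE \<omega> in m. AE t in lborel. fibre \<beta> f \<omega> t = f (\<omega> + \<beta> t)"
proof -
  interpret m: finite_measure m by (rule haar_finite_measure[OF m])
  interpret pair_sigma_finite m lborel ..
  note [measurable_cong] = haar_sets[OF m]
  have [measurable]: "f \<in> borel_measurable borel"
    using borel_measurable_integrable[OF f] measurable_cong_sets[OF haar_sets[OF m] refl] by blast
  note [measurable] = measurable_translation
  have [measurable]: "(\<lambda>p. fst p + \<beta> (snd p)) \<in> m \<Otimes>\<^sub>M lborel \<rightarrow>\<^sub>M borel"
    using measurable_flow[OF \<beta>]
    by (simp add: split_beta' cong: measurable_cong_sets sets_pair_measure_cong haar_sets[OF m])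
  have [measurable]: "(\<lambda>t. \<omega> + \<beta> t) \<in> borel \<rightarrow>\<^sub>M borel" for \<omega>
    by (intro borel_measurable_continuous_onI continuous_intros \<beta>)
  \<comment> \<open>Countably many intervals absorb every compact set, so the exceptional sets of
    \<omega> still unite to a null set.\<close>
  define I :: "nat \<Rightarrow> real set" where "I k = {- real k..real k}" for k
  have [measurable]: "I k \<in> sets borel" for k by (simp add: I_def)
  have "AE \<omega> in m. (\<integral>\<^sup>+t. norm (f (\<omega> + \<beta> t)) * indicator (I k) t \<partial>lborel) \<noteq> \<infinity>" for k
  proof (rule nn_integral_PInf_AE)
    have inv: "(\<integral>\<^sup>+\<omega>. norm (f (\<omega> + x)) \<partial>m) = (\<integral>\<^sup>+\<omega>. norm (f \<omega>) \<partial>m)" for x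
      using nn_integral_distr[of "\<lambda>\<omega>. \<omega> + x" m m "\<lambda>\<omega>. ennreal (norm (f \<omega>))"]
        haar_distr_translation[OF m, of x] by simp
    \<comment> \<open>By invariance the double integral is the length \<open>2 * k\<close> of the
      interval times the L1 norm of \<open>f\<close>, hence finite.\<close>
    have "(\<integral>\<^sup>+\<omega>. \<integral>\<^sup>+t. norm (f (\<omega> + \<beta> t)) * indicator (I k) t \<partial>lborel \<partial>m)
        = (\<integral>\<^sup>+t. \<integral>\<^sup>+\<omega>. norm (f (\<omega> + \<beta> t)) * indicator (I k) t \<partial>m \<partial>lborel)"
      by (rule Fubini'[symmetric]) measurable
    also have "\<dots> = (\<integral>\<^sup>+t. (\<integral>\<^sup>+\<omega>. norm (f \<omega>) \<partial>m) * indicator (I k) t \<partial>lborel)"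
      by (intro nn_integral_cong) (simp add: ennreal_mult' ennreal_indicator nn_integral_multc inv)
    also have "\<dots> = (\<integral>\<^sup>+\<omega>. norm (f \<omega>) \<partial>m) * ennreal (2 * real k)"
      by (simp add: nn_integral_cmult_indicator I_def)
    also have "\<dots> < \<infinity>"
      using f by (auto simp: integrable_iff_bounded ennreal_mult_less_top)
    finally show "(\<integral>\<^sup>+\<omega>. \<integral>\<^sup>+t. norm (f (\<omega> + \<beta> t)) * indicator (I k) t \<partial>lborel \<partial>m) \<noteq> \<infinity>"
      by simp
  qed measurable
  then have "AE \<omega> in m. \<forall>k. (\<integral>\<^sup>+t. norm (f (\<omega> + \<beta> t)) * indicator (I k) t \<partial>lborel) \<noteq> \<infinity>"
    by (simp add: AE_all_countable)
  then show ?thesis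
  proof eventually_elim
    case (elim \<omega>)
    let ?g = "\<lambda>t. f (\<omega> + \<beta> t)"
    have "set_integrable lborel (I k) ?g" for k
      unfolding set_integrable_def integrable_iff_bounded
      using elim[rule_format, of k] by (auto simp: mult.commute top.not_eq_extremum)
    \<comment> \<open>Absolute integrability refers to the completed measure
      \<open>lebesgue\<close>, hence the passage from \<open>lborel\<close>.\<close>
    then have I: "?g absolutely_integrable_on I k" for k
      unfolding set_integrable_def by (rule integrable_completion[THEN iffD2, rotated]) measurable
    have "locally_integrable ?g"
      unfolding locally_integrable_def
    proof (intro allI impI)
      fix K :: "real set" assume K: "compact K"
      then obtain b where b: "\<And>x. x \<in> K \<Longrightarrow> \<bar>x\<bar> \<le> b"
        using compact_imp_bounded bounded_iff by (metis real_norm_def)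
      obtain k where "b \<le> real k" using real_arch_simple by blast
      then have "K \<subseteq> I k" using b by (fastforce simp: I_def abs_le_iff)
      moreover have "K \<in> sets lebesgue" using K by (simp add: borel_compact sets_completionI_sets)
      ultimately show "?g absolutely_integrable_on K" using I set_integrable_subset by blast
    qed
    then have "\<exists>g. locally_integrable g \<and> (AE t in lborel. g t = ?g t)" by auto
    from someI_ex[OF this] show ?case by (simp add: fibre_def)
  qed
qed

section \<open>Characters and their orthogonality\<close>

text \<open>The set where two continuous functions agree is closed, and here it contains the dense
  range of \<beta>. This justifies the definite description in \<open>freq_char\<close>.\<close>

lemma extends_frequency_unique:
  fixes \<beta> :: "real \<Rightarrow> 'a::{topological_ab_group_add, t2_space}"
  assumes dense: "closure (range \<beta>) = UNIV"
    and h: "extends_frequency \<beta> x h" and k: "extends_frequency \<beta> x k"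
  shows "h = k"
proof
  fix \<omega>
  have "closed {\<omega>. h \<omega> = k \<omega>}"
    using h k by (intro closed_Collect_eq) (auto simp: extends_frequency_def character_def)
  moreover have "range \<beta> \<subseteq> {\<omega>. h \<omega> = k \<omega>}"
    using h k by (auto simp: extends_frequency_def)
  ultimately have "closure (range \<beta>) \<subseteq> {\<omega>. h \<omega> = k \<omega>}" by (rule closure_minimal[rotated])
  then show "h \<omega> = k \<omega>" using dense by auto
qed

lemma freq_char_extends:
  assumes "lambda_dirichlet_group lam \<beta>"
  shows "extends_frequency \<beta> (lam j) (freq_char \<beta> (lam j))"
proof -
  have dense: "closure (range \<beta>) = UNIV"
    using assms by (simp add: lambda_dirichlet_group_def dirichlet_group_def)
  obtain h where "extends_frequency \<beta> (lam j) h"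
    using assms by (auto simp: lambda_dirichlet_group_def)
  then have "\<exists>!h. extends_frequency \<beta> (lam j) h"
    using extends_frequency_unique[OF dense] by blast
  then show ?thesis
    unfolding freq_char_def by (rule theI')
qed

lemma integrable_character:
  assumes m: "normalized_haar_measure m" and "character \<gamma>"
  shows "integrable m \<gamma>"
proof -
  interpret finite_measure m by (rule haar_finite_measure[OF m])
  have "\<gamma> \<in> borel_measurable borel"
    using assms by (intro borel_measurable_continuous_onI) (auto simp: character_def)
  then have "\<gamma> \<in> borel_measurable m"
    using measurable_cong_sets[OF haar_sets[OF m] refl] by blast
  then show ?thesis
    using assms by (intro integrable_const_bound[where B = 1]) (auto simp: character_def)
qed

text \<open>Translating by \<open>x\<close> multiplies the integral by \<open>\<gamma> x\<close>
  and, by invariance, also leaves it unchanged.\<close>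

lemma integral_nontrivial_character:
  fixes m :: "'a::{topological_ab_group_add, t2_space} measure"
  assumes m: "normalized_haar_measure m" and \<gamma>: "character \<gamma>" and x: "\<gamma> x \<noteq> 1"
  shows "(\<integral>\<omega>. \<gamma> \<omega> \<partial>m) = 0"
proof -
  note [measurable_cong] = haar_sets[OF m]
  note [measurable] = measurable_translation borel_measurable_integrable[OF integrable_character[OF m \<gamma>]]
  have "(\<integral>\<omega>. \<gamma> \<omega> \<partial>m) = (\<integral>\<omega>. \<gamma> \<omega> \<partial>distr m m (\<lambda>\<omega>. \<omega> + x))"
    by (simp add: haar_distr_translation[OF m])
  also have "\<dots> = (\<integral>\<omega>. \<gamma> (\<omega> + x) \<partial>m)"
    by (rule integral_distr) measurable
  also have "\<dots> = \<gamma> x * (\<integral>\<omega>. \<gamma> \<omega> \<partial>m)"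
    using \<gamma> by (simp add: character_def mult.commute)
  finally show ?thesis using x by simp
qed

lemma character_mult_cnj:
  assumes "character \<gamma>" "character \<delta>"
  shows "character (\<lambda>\<omega>. \<gamma> \<omega> * cnj (\<delta> \<omega>))"
  using assms by (simp add: character_def norm_mult continuous_on_mult continuous_on_cnj)

lemma fourier_coeff_freq_char:
  assumes lam: "inj lam" and \<beta>: "lambda_dirichlet_group lam \<beta>"
    and m: "normalized_haar_measure m"
  shows "fourier_coeff m (freq_char \<beta> (lam i)) (freq_char \<beta> (lam j)) = (if i = j then 1 else 0)"
proof -
  interpret finite_measure m by (rule haar_finite_measure[OF m])
  let ?h = "\<lambda>j. freq_char \<beta> (lam j)"
  have h: "character (?h j)" "?h j (\<beta> t) = exp (- \<i> * of_real (lam j) * of_real t)" for j t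
    using freq_char_extends[OF \<beta>] by (auto simp: extends_frequency_def)
  show ?thesis
  proof (cases "i = j")
    case True
    have "?h j \<omega> * cnj (?h j \<omega>) = 1" for \<omega>
      using h(1)[of j] by (simp add: character_def complex_norm_square[symmetric])
    then show ?thesis using True by (simp add: fourier_coeff_def measure_def haar_emeasure_space[OF m])
  next
    case False
    \<comment> \<open>At this time the quotient of the two characters takes the value
      \<open>exp (- \<i> * pi) = - 1\<close>, so it is nontrivial; injectivity of \<open>lam\<close>
      keeps the denominator nonzero.\<close>
    define t where "t = pi / (lam i - lam j)"
    have "lam i - lam j \<noteq> 0" using False lam by (simp add: inj_eq)
    then have t: "(lam i - lam j) * t = pi" by (simp add: t_def)
    have "?h i (\<beta> t) * cnj (?h j (\<beta> t)) = exp (- \<i> * of_real ((lam i - lam j) * t))"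
      by (simp add: h exp_cnj exp_add[symmetric] algebra_simps)
    also have "\<dots> = - 1" unfolding t by (simp add: exp_minus)
    finally show ?thesis
      using integral_nontrivial_character[OF m character_mult_cnj[OF h(1)[of i] h(1)[of j]], of "\<beta> t"]
        False by (simp add: fourier_coeff_def)
  qed
qed

section \<open>Dirichlet polynomials and their twists\<close>

text \<open>Evaluation sums over the exact support; this allows a fixed finite index set, so that
  the support of a twist need not be determined.\<close>

lemma dirichlet_poly_eval_supset:
  assumes "finite J" "\<And>j. j \<notin> J \<Longrightarrow> D j = 0"
  shows "dirichlet_poly_eval lam D s = (\<Sum>j\<in>J. D j * exp (- of_real (lam j) * s))"
  unfolding dirichlet_poly_eval_def
  by (rule sum.mono_neutral_left) (use assms in auto)

text \<open>Orthogonality of the characters picks out each coefficient, and an equality almost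
  everywhere is enough under the integral.\<close>

lemma bohr_transform_polynomial:
  assumes lam: "inj lam" and \<beta>: "lambda_dirichlet_group lam \<beta>"
    and m: "normalized_haar_measure m" and g: "integrable m g"
    and J: "finite J" and eq: "AE \<omega> in m. g \<omega> = (\<Sum>j\<in>J. c j * freq_char \<beta> (lam j) \<omega>)"
  shows "bohr_transform m lam \<beta> g = (\<lambda>j. if j \<in> J then c j else 0)"
proof
  fix i
  let ?h = "\<lambda>j. freq_char \<beta> (lam j)"
  have h: "character (?h j)" for j
    using freq_char_extends[OF \<beta>] by (auto simp: extends_frequency_def)
  have [measurable]: "(\<lambda>\<omega>. ?h j \<omega>) \<in> borel_measurable m"
    "(\<lambda>\<omega>. cnj (?h j \<omega>)) \<in> borel_measurable m" for j
    using borel_measurable_integrable[OF integrable_character[OF m h]]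
    by (auto intro: borel_measurable_continuous_on[OF continuous_on_cnj[OF continuous_on_id]])
  note [measurable] = borel_measurable_integrable[OF g]
  have "bohr_transform m lam \<beta> g i = (\<integral>\<omega>. (\<Sum>j\<in>J. c j * (?h j \<omega> * cnj (?h i \<omega>))) \<partial>m)"
    unfolding bohr_transform_def fourier_coeff_def
  proof (rule integral_cong_AE)
    show "AE \<omega> in m. g \<omega> * cnj (?h i \<omega>) = (\<Sum>j\<in>J. c j * (?h j \<omega> * cnj (?h i \<omega>)))"
      using eq by eventually_elim (simp add: sum_distrib_right mult.assoc)
  qed measurable
  also have "\<dots> = (\<Sum>j\<in>J. c j * fourier_coeff m (?h j) (?h i))"
    unfolding fourier_coeff_def
    by (subst Bochner_Integration.integral_sum)
       (simp_all add: integrable_character[OF m] character_mult_cnj h)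
  also have "\<dots> = (if i \<in> J then c i else 0)"
    using J by (simp add: fourier_coeff_freq_char[OF lam \<beta> m] if_distrib cong: if_cong)
  finally show "bohr_transform m lam \<beta> g i = (if i \<in> J then c i else 0)" .
qed

text \<open>Each character is multiplicative and equals an exponential along \<beta>, so moving up
  the imaginary axis amounts to following the flow.\<close>

lemma twist_eval_shift:
  assumes \<beta>: "lambda_dirichlet_group lam \<beta>"
    and "finite {j. D j \<noteq> 0}"
  shows "dirichlet_poly_eval lam (twist lam \<beta> D \<omega>) (\<i> * of_real t)
    = dirichlet_poly_eval lam (twist lam \<beta> D (\<omega> + \<beta> t)) 0"
proof -
  have h: "freq_char \<beta> (lam j) (\<omega> + \<beta> t)
      = freq_char \<beta> (lam j) \<omega> * exp (- of_real (lam j) * (\<i> * of_real t))" for j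
    using freq_char_extends[OF \<beta>, of j]
    by (simp add: extends_frequency_def character_def algebra_simps)
  have ev: "dirichlet_poly_eval lam (twist lam \<beta> D \<omega>') s
      = (\<Sum>j | D j \<noteq> 0. twist lam \<beta> D \<omega>' j * exp (- of_real (lam j) * s))" for \<omega>' s
    by (rule dirichlet_poly_eval_supset) (use assms in \<open>auto simp: twist_def\<close>)
  show ?thesis unfolding ev by (simp add: twist_def h mult.assoc)
qed

lemma measurable_twist_eval:
  assumes \<beta>: "lambda_dirichlet_group lam \<beta>" and "finite {j. D j \<noteq> 0}"
  shows "(\<lambda>\<omega>. dirichlet_poly_eval lam (twist lam \<beta> D \<omega>) 0) \<in> borel_measurable borel"
proof -
  have "(\<lambda>\<omega>. dirichlet_poly_eval lam (twist lam \<beta> D \<omega>) 0)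
      = (\<lambda>\<omega>. \<Sum>j | D j \<noteq> 0. D j * freq_char \<beta> (lam j) \<omega>)"
    by (rule ext, subst dirichlet_poly_eval_supset[where J = "{j. D j \<noteq> 0}"])
       (use assms in \<open>auto simp: twist_def\<close>)
  moreover have "continuous_on UNIV (freq_char \<beta> (lam j))" for j
    using freq_char_extends[OF \<beta>, of j] by (simp add: extends_frequency_def character_def)
  ultimately show ?thesis
    by (simp add: borel_measurable_continuous_onI continuous_intros)
qed

text \<open>At \<open>0\<close> all exponentials are 1, so the recovered coefficients rebuild the
  polynomial from its characters.\<close>

lemma H1_polynomial_twist:
  assumes lam: "inj lam" and \<beta>: "lambda_dirichlet_group lam \<beta>"
    and m: "normalized_haar_measure m" and g: "integrable m g"
    and poly: "H1_polynomial m lam \<beta> g"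
  shows "finite {j. bohr_transform m lam \<beta> g j \<noteq> 0}"
    and "AE \<omega> in m. dirichlet_poly_eval lam (twist lam \<beta> (bohr_transform m lam \<beta> g) \<omega>) 0 = g \<omega>"
proof -
  obtain J c where J: "finite J" and eq: "AE \<omega> in m. g \<omega> = (\<Sum>j\<in>J. c j * freq_char \<beta> (lam j) \<omega>)"
    using poly by (auto simp: H1_polynomial_def)
  note D = bohr_transform_polynomial[OF lam \<beta> m g J eq]
  show "finite {j. bohr_transform m lam \<beta> g j \<noteq> 0}"
    by (rule finite_subset[OF _ J]) (auto simp: D)
  show "AE \<omega> in m. dirichlet_poly_eval lam (twist lam \<beta> (bohr_transform m lam \<beta> g) \<omega>) 0 = g \<omega>"
    using eq by eventually_elim
      (subst dirichlet_poly_eval_supset[OF J], auto simp: twist_def D intro!: sum.cong)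
qed

section \<open>Convergence on the group and along orbits\<close>

text \<open>Testing only the tolerances \<open>1 / Suc k\<close> expresses convergence by countable
  quantifiers over measurable conditions.\<close>

lemma pred_LIMSEQ:
  fixes u :: "nat \<Rightarrow> 'a \<Rightarrow> complex"
  assumes [measurable]: "\<And>n. u n \<in> borel_measurable M" "v \<in> borel_measurable M"
  shows "Measurable.pred M (\<lambda>x. (\<lambda>n. u n x) \<longlonglongrightarrow> v x)"
proof -
  have "(\<lambda>n. u n x) \<longlonglongrightarrow> v x \<longleftrightarrow> (\<forall>k::nat. \<exists>N. \<forall>n\<ge>N. dist (u n x) (v x) < 1 / real (Suc k))" for x
    unfolding lim_sequentially
    by (meson nat_approx_posE less_trans of_nat_0_less_iff zero_less_Suc zero_less_divide_1_iff)
  then show ?thesis by simp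
qed

text \<open>Common form of both fibre statements: \<open>v\<close> is either the chosen fibre of a
  function or a twisted polynomial on the imaginary axis. Only countably many functions are replaced
  by their orbit values, so the exceptional sets remain null.\<close>

lemma AE_LIMSEQ_flow_iff:
  fixes \<beta> :: "real \<Rightarrow> 'a::{topological_ab_group_add, t2_space}"
  assumes \<beta>: "continuous_on UNIV \<beta>" and m: "normalized_haar_measure m"
    and u: "\<And>n. u n \<in> borel_measurable borel"
    and f: "integrable m f"
    and v: "\<And>n. AE \<omega> in m. AE t in lborel. v n \<omega> t = u n (\<omega> + \<beta> t)"
  shows "(AE \<omega> in m. AE t in lborel. (\<lambda>n. v n \<omega> t) \<longlonglongrightarrow> fibre \<beta> f \<omega> t) \<longleftrightarrow>
    (AE \<omega> in m. (\<lambda>n. u n \<omega>) \<longlonglongrightarrow> (f \<omega> :: complex))"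
proof -
  have "f \<in> borel_measurable borel"
    using borel_measurable_integrable[OF f] measurable_cong_sets[OF haar_sets[OF m] refl] by blast
  note iff = AE_flow_iff[OF \<beta> m pred_LIMSEQ[OF u this]]
  have "AE \<omega> in m. \<forall>n. AE t in lborel. v n \<omega> t = u n (\<omega> + \<beta> t)"
    using v by (simp add: AE_all_countable)
  then have "AE \<omega> in m. (AE t in lborel. (\<lambda>n. v n \<omega> t) \<longlonglongrightarrow> fibre \<beta> f \<omega> t) \<longleftrightarrow>
      (AE t in lborel. (\<lambda>n. u n (\<omega> + \<beta> t)) \<longlonglongrightarrow> f (\<omega> + \<beta> t))"
    using AE_fibre_eq[OF \<beta> m f]
  proof eventually_elim
    case (elim \<omega>)
    have "AE t in lborel. \<forall>n. v n \<omega> t = u n (\<omega> + \<beta> t)"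
      using elim(1) by (simp add: AE_all_countable)
    then have "AE t in lborel. ((\<lambda>n. v n \<omega> t) \<longlonglongrightarrow> fibre \<beta> f \<omega> t) \<longleftrightarrow>
        ((\<lambda>n. u n (\<omega> + \<beta> t)) \<longlonglongrightarrow> f (\<omega> + \<beta> t))"
      using elim(2) by eventually_elim simp
    then show ?case by (rule eventually_subst)
  qed
  \<comment> \<open>Equivalence for almost every \<omega> turns the fibre statement into the orbit
    statement, to which Fubini applies.\<close>
  from eventually_subst[OF this] show ?thesis using iff by (rule trans)
qed

theorem lemma1p4:
  fixes lam :: "nat \<Rightarrow> real"
    and \<beta> :: "real \<Rightarrow> 'a::{topological_ab_group_add, t2_space}"
    and m :: "'a measure"
    and f :: "'a \<Rightarrow> complex"
    and fs :: "nat \<Rightarrow> 'a \<Rightarrow> complex"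
  assumes "frequency lam"
    and "lambda_dirichlet_group lam \<beta>"
    and "normalized_haar_measure m"
    and "\<And>n. fs n \<in> hardy_H1 m lam \<beta>"
    and "f \<in> hardy_H1 m lam \<beta>"
  shows "((AE \<omega> in m. (\<lambda>n. fs n \<omega>) \<longlonglongrightarrow> f \<omega>) \<longleftrightarrow>
          (AE \<omega> in m. AE t in lborel. (\<lambda>n. fibre \<beta> (fs n) \<omega> t) \<longlonglongrightarrow> fibre \<beta> f \<omega> t)) \<and>
    (\<forall>D. (\<forall>n. H1_polynomial m lam \<beta> (fs n)) \<and> (\<forall>n. D n = bohr_transform m lam \<beta> (fs n)) \<longrightarrow>
         ((AE \<omega> in m. (\<lambda>n. fs n \<omega>) \<longlonglongrightarrow> f \<omega>) \<longleftrightarrow>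
          (AE \<omega> in m. (\<lambda>n. dirichlet_poly_eval lam (twist lam \<beta> (D n) \<omega>) 0) \<longlonglongrightarrow> f \<omega>)) \<and>
         ((AE \<omega> in m. (\<lambda>n. fs n \<omega>) \<longlonglongrightarrow> f \<omega>) \<longleftrightarrow>
          (AE \<omega> in m. AE t in lborel.
             (\<lambda>n. dirichlet_poly_eval lam (twist lam \<beta> (D n) \<omega>) (\<i> * of_real t))
               \<longlonglongrightarrow> fibre \<beta> f \<omega> t)))"
proof -
  note m = assms(3)
  have inj: "inj lam"
    using assms(1) by (simp add: frequency_def inj_def strict_mono_eq)
  have \<beta>: "continuous_on UNIV \<beta>"
    using assms(2) by (simp add: lambda_dirichlet_group_def dirichlet_group_def)
  have fs: "integrable m (fs n)" for n using assms(4) by (simp add: hardy_H1_def)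
  have f: "integrable m f" using assms(5) by (simp add: hardy_H1_def)
  have fs_borel: "fs n \<in> borel_measurable borel" for n
    using borel_measurable_integrable[OF fs] measurable_cong_sets[OF haar_sets[OF m] refl] by blast
  show ?thesis
  proof (intro conjI allI impI)
    show "(AE \<omega> in m. (\<lambda>n. fs n \<omega>) \<longlonglongrightarrow> f \<omega>) \<longleftrightarrow>
        (AE \<omega> in m. AE t in lborel. (\<lambda>n. fibre \<beta> (fs n) \<omega> t) \<longlonglongrightarrow> fibre \<beta> f \<omega> t)"
      by (rule AE_LIMSEQ_flow_iff[OF \<beta> m fs_borel f AE_fibre_eq[OF \<beta> m fs], symmetric])
  next
    fix D :: "nat \<Rightarrow> dirichlet_series"
    assume asm: "(\<forall>n. H1_polynomial m lam \<beta> (fs n)) \<and> (\<forall>n. D n = bohr_transform m lam \<beta> (fs n))"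
    have fin: "finite {j. D n j \<noteq> 0}" for n
      using H1_polynomial_twist(1)[OF inj assms(2) m fs, of n] asm by simp
    let ?p = "\<lambda>n \<omega>. dirichlet_poly_eval lam (twist lam \<beta> (D n) \<omega>) 0"
    have "AE \<omega> in m. ?p n \<omega> = fs n \<omega>" for n
      using H1_polynomial_twist(2)[OF inj assms(2) m fs, of n] asm by simp
    then have "AE \<omega> in m. \<forall>n. ?p n \<omega> = fs n \<omega>" by (simp add: AE_all_countable)
    then have "AE \<omega> in m. ((\<lambda>n. fs n \<omega>) \<longlonglongrightarrow> f \<omega>) \<longleftrightarrow> ((\<lambda>n. ?p n \<omega>) \<longlonglongrightarrow> f \<omega>)"
      by eventually_elim simp
    then show eq: "(AE \<omega> in m. (\<lambda>n. fs n \<omega>) \<longlonglongrightarrow> f \<omega>) \<longleftrightarrow> (AE \<omega> in m. (\<lambda>n. ?p n \<omega>) \<longlonglongrightarrow> f \<omega>)"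
      by (rule eventually_subst)
    show "(AE \<omega> in m. (\<lambda>n. fs n \<omega>) \<longlonglongrightarrow> f \<omega>) \<longleftrightarrow>
        (AE \<omega> in m. AE t in lborel.
          (\<lambda>n. dirichlet_poly_eval lam (twist lam \<beta> (D n) \<omega>) (\<i> * of_real t)) \<longlonglongrightarrow> fibre \<beta> f \<omega> t)"
      \<comment> \<open>Passing to the polynomials \<open>?p n\<close> makes the orbit identity hold
        for every \<omega> and \<open>t\<close>, with no exceptional set.\<close>
      unfolding eq
      by (rule AE_LIMSEQ_flow_iff[OF \<beta> m measurable_twist_eval[OF assms(2) fin] f, symmetric])
         (simp add: twist_eval_shift[OF assms(2) fin])
  qed
qed

end
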